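(* Let $m\ge1$ and let $a_1,\dots,a_m>-1$ be fixed. Then for every complex $z\ne0$ the limiting eigenvalue density satisfies $$R_1(z):=\lim_{N\to\infty}N^{m-1}R_{N,1}(N^{m/2}z)=\frac1{m\pi}|z|^{\frac2m-2}\,\chi_{\{u:|u|<1\}}(z).$$
   Context: $R_{N,1}$ is the one-point eigenvalue correlation function of the product $X_mX_{m-1}\cdots X_1$ of independent $N\times N$ matrices, $X_k$ having density proportional to $(\det X_k^*X_k)^{a_k}e^{-\mathrm{tr}(X_k^*X_k)}$. Explicitly, $R_{N,1}(z)=K_N(z,z)$ with $$K_N(z,z')=\sqrt{w_m(z)w_m(\overline{z'})}\sum_{l=0}^{N-1}\prod_{k=1}^m\frac{\Gamma(a_k+1)}{\Gamma(a_k+l+1)}(z\overline{z'})^l,$$ $$w_m(z)=|z|^{2a_m}\frac{2^{m-1}}{\pi}\prod_{k=1}^m\frac1{\Gamma(a_k+1)}\int_{\mathbb{R}_+^{m-1}}\exp\Big\{-\sum_{k=1}^{m-1}r_k^2-\frac{|z|^2}{r_1^2\cdots r_{m-1}^2}\Big\}\prod_{k=1}^{m-1}r_k^{2(a_k-a_m)-1}\,d^{m-1}r$$ (for $m=1$ the integral is read as $e^{-|z|^2}$). The function $\chi_{\{u:|u|<1\}}(z)$ equals $1$ for $|z|<1$, $1/2$ for $|z|=1$, and $0$ otherwise. *)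

theory Defs
  imports "HOL-Analysis.Analysis"
begin

(* The integral runs over (0,\<infinity>)^(m-1), realised inside the product of m-1 copies of
   Lebesgue-Borel measure indexed by {1..<m}. For m = 1 the index set is empty, that product is a
   unit point mass, all products over {1..<m} are 1, and the integral is exp (- |z|^2).
   At z = 0 the value is a mere convention (0 powr x = 0). *)
definition weight :: "nat \<Rightarrow> (nat \<Rightarrow> real) \<Rightarrow> complex \<Rightarrow> real" where
  "weight m a z =
     cmod z powr (2 * a m) * (2 ^ (m - 1) / pi) * (\<Prod>k=1..m. 1 / Gamma (a k + 1)) *
     set_lebesgue_integral (PiM {1..<m} (\<lambda>_. lborel)) (PiE {1..<m} (\<lambda>_. {0<..}))
       (\<lambda>r. exp (- (\<Sum>k\<in>{1..<m}. (r k)\<^sup>2) - (cmod z)\<^sup>2 / (\<Prod>k\<in>{1..<m}. (r k)\<^sup>2)) *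
            (\<Prod>k\<in>{1..<m}. r k powr (2 * (a k - a m) - 1)))"

definition kernel :: "nat \<Rightarrow> (nat \<Rightarrow> real) \<Rightarrow> nat \<Rightarrow> complex \<Rightarrow> complex \<Rightarrow> complex" where
  "kernel m a N z z' =
     of_real (sqrt (weight m a z * weight m a (cnj z'))) *
     (\<Sum>l<N. of_real (\<Prod>k=1..m. Gamma (a k + 1) / Gamma (a k + real l + 1)) * (z * cnj z') ^ l)"

(* The one-point eigenvalue correlation function R_{N,1} of X_m ... X_1, where the independent
   N x N matrices X_k have density proportional to det(X_k^* X_k)^(a k) * exp(- tr(X_k^* X_k)).
   As a density it is determined only almost everywhere; the diagonal of the correlation kernel
   is the version with pointwise values. *)
definition one_point_corr :: "nat \<Rightarrow> (nat \<Rightarrow> real) \<Rightarrow> nat \<Rightarrow> complex \<Rightarrow> complex" where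
  "one_point_corr m a N z = kernel m a N z z"

definition chi_disc :: "complex \<Rightarrow> real" where
  "chi_disc z = (if cmod z < 1 then 1 else if cmod z = 1 then 1 / 2 else 0)"

end

(* Let n = N |z|^(2/m). The weight at N^(m/2) z is an (m-1)-fold integral which, after the
   substitution r = sqrt n * exp (v / (2 sqrt n)), is an explicit factor times a Laplace integral converging to
   a Gaussian integral. The explicit factor combines with the l-th coefficient of the kernel to
   prod_k n^(a_k+l) e^(-n) / Gamma(a_k+l+1), a product of generalised Poisson weights. At
   l = n + t sqrt n each of them is asymptotic to a Gaussian density in t over sqrt n (Stirling's
   formula, itself the case of a single variable of the same Laplace integral), so the sum over
   l < N becomes a Gaussian integral over a window that, in the limit, is everything, a half-line
   or empty. *)
theory Submission
  imports Defs "HOL-Probability.Probability" "HOL-Real_Asymp.Real_Asymp"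
begin

text \<open>The substitution is centred at the saddle r_k^2 = n. At the rescaled point |z|^2 becomes
  n^m, so the quotient |z|^2 / prod r_k^2 acts as an m-th squared radius: the m quantities have
  product n^m and least sum m n. Their logarithmic deviations from n add up to zero, so linear terms
  cancel, and the limiting quadratic form is the identity plus the all-ones matrix of size m - 1,
  with determinant m. This gives (2 pi)^((m-1)/2) / sqrt m. The sum over l gives the integral of the
  m-th power of a Gaussian density, whose constant is 1 / (sqrt m (2 pi)^((m-1)/2)); the powers of 2
  pi cancel and the two roots make 1/m. The obstacle is the passage to the limit under both
  integrals, which takes dominating functions independent of n. For the Poisson weights a Gaussian
  one is available only for l = O(n), and the cut l < N provides exactly this range.\<close>

section \<open>Exponential substitution on the positive orthant\<close>

text \<open>Substitution on compact intervals, followed by continuity from below of the two density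
  measures. With values in \<open>ennreal\<close> there is no integrability to check.\<close>

lemma nn_integral_exp_substitution:
  fixes f :: "real \<Rightarrow> ennreal"
  assumes [measurable]: "f \<in> borel_measurable borel" and AB: "A > 0" "B > 0"
  shows "(\<integral>\<^sup>+r. f r * indicator {0<..} r \<partial>lborel) =
         (\<integral>\<^sup>+v. f (A * exp (B * v)) * ennreal (A * B * exp (B * v)) \<partial>lborel)"
proof -
  define g where "g v = A * exp (B * v)" for v
  define h where "h v = f (g v) * ennreal (B * g v)" for v
  have [measurable]: "g \<in> borel_measurable borel" unfolding g_def by measurable
  have [measurable]: "h \<in> borel_measurable borel" unfolding h_def by measurable
  \<comment> \<open>\<open>Suc k\<close> keeps every interval nondegenerate; the intervals
    \<open>?T k\<close> exhaust the line and their images \<open>?S k\<close> the positive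
    half-line.\<close>
  let ?S = "\<lambda>k. {g (- real (Suc k))..g (real (Suc k))}" and ?T = "\<lambda>k. {- real (Suc k)..real (Suc k)}"
  have dg: "(g has_real_derivative B * g v) (at v)" for v
    unfolding g_def by (auto intro!: derivative_eq_intros)
  have g_mono: "g u \<le> g v \<longleftrightarrow> u \<le> v" for u v using AB by (simp add: g_def)
  have S: "(\<Union>k. ?S k) = {0<..}"
  proof safe
    fix x :: real assume "x > 0"
    then have x: "x = g (ln (x / A) / B)" using AB by (simp add: g_def)
    obtain k :: nat where "\<bar>ln (x / A) / B\<bar> \<le> real k" using real_arch_simple by blast
    then have "x \<in> ?S k" by (subst (1) x, simp only: atLeastAtMost_iff g_mono) linarith
    then show "x \<in> (\<Union>k. ?S k)" by blast
  next
    fix x k assume "x \<in> ?S k"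
    moreover have "0 < g (- real (Suc k))" using AB by (simp add: g_def)
    ultimately show "x > 0" by auto
  qed
  have T: "(\<Union>k. ?T k) = UNIV"
  proof safe
    fix x :: real
    obtain k :: nat where "\<bar>x\<bar> \<le> real k" using real_arch_simple by blast
    then have "x \<in> ?T k" by auto
    then show "x \<in> (\<Union>k. ?T k)" by blast
  qed simp
  have "emeasure (density lborel f) (?S k) = emeasure (density lborel h) (?T k)" for k
    using AB
    by (simp add: emeasure_density del: of_nat_Suc, subst nn_integral_substitution_aux
        [where g = g and g' = "\<lambda>v. B * g v"])
      (auto intro!: dg continuous_intros simp: h_def mult_ac, auto simp: g_def intro!: continuous_intros)
  moreover have "(SUP k. emeasure (density lborel f) (?S k)) = emeasure (density lborel f) {0<..}"
    unfolding S[symmetric] by (rule SUP_emeasure_incseq) (auto simp: incseq_def g_def AB intro: order_trans)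
  moreover have "(SUP k. emeasure (density lborel h) (?T k)) = emeasure (density lborel h) UNIV"
    unfolding T[symmetric] by (rule SUP_emeasure_incseq) (auto simp: incseq_def)
  ultimately have "emeasure (density lborel f) {0<..} = emeasure (density lborel h) UNIV"
    by simp
  then show ?thesis by (simp add: emeasure_density h_def g_def mult_ac)
qed

interpretation lborel_family: product_sigma_finite "\<lambda>_::nat. lborel :: real measure" ..

text \<open>Tonelli, one coordinate at a time. The restricted abstraction keeps the new point
  extensional, hence in the space of the product measure.\<close>

lemma nn_integral_PiM_exp_substitution:
  fixes f :: "(nat \<Rightarrow> real) \<Rightarrow> ennreal"
  assumes "finite I" "A > 0" "B > 0" "f \<in> borel_measurable (PiM I (\<lambda>_. lborel))"
  shows "(\<integral>\<^sup>+r. f r * (\<Prod>i\<in>I. indicator {0<..} (r i)) \<partial>PiM I (\<lambda>_. lborel)) =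
         (\<integral>\<^sup>+v. f (\<lambda>i\<in>I. A * exp (B * v i)) * (\<Prod>i\<in>I. ennreal (A * B * exp (B * v i)))
           \<partial>PiM I (\<lambda>_. lborel))"
  using assms(1,4)
proof (induction I arbitrary: f rule: finite_induct)
  case empty
  then show ?case by (subst (1 2) lborel_family.nn_integral_empty) (auto simp: restrict_def)
next
  case (insert i I)
  note [measurable] = insert.prems
  let ?P = "\<lambda>v. \<Prod>j\<in>I. ennreal (A * B * exp (B * v j))"
  let ?F = "\<lambda>y. \<integral>\<^sup>+v. f ((\<lambda>j\<in>I. A * exp (B * v j))(i := y)) * ?P v \<partial>PiM I (\<lambda>_. lborel)"
  have I: "finite I" "i \<notin> I" by fact+
  have upd: "(\<Prod>j\<in>I. g ((x(i := y)) j)) = (\<Prod>j\<in>I. g (x j))"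
    for g :: "real \<Rightarrow> ennreal" and x y using I by (intro prod.cong) auto
  have [measurable]: "(\<lambda>p. (\<lambda>j\<in>I. A * exp (B * snd p j))(i := fst p))
      \<in> lborel \<Otimes>\<^sub>M PiM I (\<lambda>_. lborel) \<rightarrow>\<^sub>M PiM (insert i I) (\<lambda>_. lborel)"
    by measurable
  interpret sigma_finite_measure "PiM I (\<lambda>_::nat. lborel :: real measure)"
    by (rule lborel_family.sigma_finite[OF I(1)])
  have F: "?F \<in> borel_measurable borel"
    by measurable
  have "(\<integral>\<^sup>+r. f r * (\<Prod>j\<in>insert i I. indicator {0<..} (r j)) \<partial>PiM (insert i I) (\<lambda>_. lborel)) =
        (\<integral>\<^sup>+y. (\<integral>\<^sup>+x. f (x(i := y)) * (\<Prod>j\<in>I. indicator {0<..} (x j)) \<partial>PiM I (\<lambda>_. lborel)) *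
            indicator {0<..} y \<partial>lborel)"
    (is "_ = ?R")
  proof -
    have "?R = (\<integral>\<^sup>+y. \<integral>\<^sup>+x. f (x(i := y)) * (\<Prod>j\<in>I. indicator {0<..} (x j)) * indicator {0<..} y
        \<partial>PiM I (\<lambda>_. lborel) \<partial>lborel)"
      by (intro nn_integral_cong nn_integral_multc[symmetric]) measurable
    also have "\<dots> = (\<integral>\<^sup>+y. \<integral>\<^sup>+x. f (x(i := y)) * (\<Prod>j\<in>insert i I. indicator {0<..} ((x(i := y)) j))
        \<partial>PiM I (\<lambda>_. lborel) \<partial>lborel)"
      using I by (simp add: upd mult_ac del: fun_upd_apply) (simp add: mult_ac)
    finally show ?thesis
      using I by (subst lborel_family.product_nn_integral_insert_rev) auto
  qed
  also have "\<dots> = (\<integral>\<^sup>+y. ?F y * indicator {0<..} y \<partial>lborel)"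
    by (intro nn_integral_cong arg_cong2[where f = times] insert.IH refl) measurable
  also have "\<dots> = (\<integral>\<^sup>+u. ?F (A * exp (B * u)) * ennreal (A * B * exp (B * u)) \<partial>lborel)"
    by (rule nn_integral_exp_substitution[OF F assms(2,3)])
  also have "\<dots> = (\<integral>\<^sup>+v. f (\<lambda>j\<in>insert i I. A * exp (B * v j)) *
      (\<Prod>j\<in>insert i I. ennreal (A * B * exp (B * v j))) \<partial>PiM (insert i I) (\<lambda>_. lborel))"
    (is "?L = _")
  proof -
    have res: "(\<lambda>j\<in>insert i I. A * exp (B * (v(i := u)) j)) =
        (\<lambda>j\<in>I. A * exp (B * v j))(i := A * exp (B * u))" for v u
      using I by (auto simp: fun_eq_iff restrict_def)
    have pr: "(\<Prod>j\<in>insert i I. ennreal (A * B * exp (B * (v(i := u)) j))) =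
        ?P v * ennreal (A * B * exp (B * u))" for v u
      using I upd[of "\<lambda>x. ennreal (A * B * exp (B * x))" v u] by (simp add: mult_ac)
    have "?L = (\<integral>\<^sup>+u. \<integral>\<^sup>+v. f ((\<lambda>j\<in>I. A * exp (B * v j))(i := A * exp (B * u))) * ?P v *
        ennreal (A * B * exp (B * u)) \<partial>PiM I (\<lambda>_. lborel) \<partial>lborel)"
      by (intro nn_integral_cong nn_integral_multc[symmetric]) measurable
    also have "\<dots> = (\<integral>\<^sup>+u. \<integral>\<^sup>+v. f (\<lambda>j\<in>insert i I. A * exp (B * (v(i := u)) j)) *
        (\<Prod>j\<in>insert i I. ennreal (A * B * exp (B * (v(i := u)) j)))
        \<partial>PiM I (\<lambda>_. lborel) \<partial>lborel)"
      unfolding res pr by (simp only: mult_ac)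
    finally show ?thesis
      using I by (subst lborel_family.product_nn_integral_insert_rev) auto
  qed
  finally show ?case .
qed

section \<open>Gaussian integrals with a rank-one perturbation\<close>

text \<open>Completing the square: the integrand is a multiple of the normal density with mean -c b
  / (1 + c) and variance 1 / (1 + c).\<close>

lemma nn_integral_gaussian:
  fixes c b :: real
  assumes "c \<ge> 0"
  shows "(\<integral>\<^sup>+v. ennreal (exp (- v\<^sup>2 / 2 - c / 2 * (v + b)\<^sup>2)) \<partial>lborel) =
         ennreal (sqrt (2 * pi / (1 + c)) * exp (- (c / (2 * (1 + c))) * b\<^sup>2))"
proof -
  define s where "s = 1 / sqrt (1 + c)"
  define \<mu> where "\<mu> = - c * b / (1 + c)"
  define K where "K = sqrt (2 * pi / (1 + c)) * exp (- (c / (2 * (1 + c))) * b\<^sup>2)"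
  have s: "s > 0" "s\<^sup>2 = 1 / (1 + c)" using assms by (auto simp: s_def power_divide)
  have K: "K \<ge> 0" using assms by (simp add: K_def)
  have "exp (- v\<^sup>2 / 2 - c / 2 * (v + b)\<^sup>2) = K * normal_density \<mu> s v" for v
  proof -
    have 1: "- v\<^sup>2 / 2 - c / 2 * (v + b)\<^sup>2 =
        - (c / (2 * (1 + c))) * b\<^sup>2 + - (v - \<mu>)\<^sup>2 / (2 * s\<^sup>2)"
    proof -
      define D where "D = 1 + c"
      have D: "c = D - 1" "D > 0" using assms by (auto simp: D_def)
      show ?thesis unfolding s(2) \<mu>_def unfolding D(1) using D(2)
        by (simp add: field_simps power2_eq_square)
    qed
    have 2: "sqrt (2 * pi / (1 + c)) > 0" using assms by simp
    then show ?thesis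
      unfolding 1 exp_add normal_density_def K_def using s assms by simp
  qed
  then have "(\<integral>\<^sup>+v. ennreal (exp (- v\<^sup>2 / 2 - c / 2 * (v + b)\<^sup>2)) \<partial>lborel) =
      (\<integral>\<^sup>+v. ennreal K * ennreal (normal_density \<mu> s v) \<partial>lborel)"
    using K by (simp add: ennreal_mult')
  also have "\<dots> = ennreal K * ennreal (\<integral>v. normal_density \<mu> s v \<partial>lborel)"
    using s by (subst nn_integral_cmult) (auto simp: nn_integral_eq_integral)
  also have "\<dots> = ennreal K" using s by simp
  finally show ?thesis by (simp add: K_def)
qed

text \<open>The factor 1 + c |I| is the determinant of the identity plus c times the all-ones
  matrix. The shift \<open>b\<close> carries the induction: once a coordinate y is split off, the
  others see the shift y + b.\<close>

lemma nn_integral_PiM_gaussian: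
  assumes "finite I" "c \<ge> 0"
  shows "(\<integral>\<^sup>+v. ennreal (exp (- (\<Sum>i\<in>I. (v i)\<^sup>2) / 2 - c / 2 * ((\<Sum>i\<in>I. v i) + b)\<^sup>2))
            \<partial>PiM I (\<lambda>_::nat. lborel)) =
         ennreal ((2 * pi) powr (real (card I) / 2) / sqrt (1 + c * real (card I)) *
            exp (- (c / (2 * (1 + c * real (card I)))) * b\<^sup>2))"
  using assms(1)
proof (induction I arbitrary: b rule: finite_induct)
  case empty
  then show ?case by (subst lborel_family.nn_integral_empty) auto
next
  case (insert i I)
  have I: "finite I" "i \<notin> I" by fact+
  define k where "k = real (card I)"
  \<comment> \<open>The coordinates in \<open>I\<close> leave a Gaussian in y + b with this
    coefficient. Integrating over y turns it into c' / (1 + c') = c / (1 + c (k + 1)), the same form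
    with k + 1.\<close>
  define c' where "c' = c / (1 + c * k)"
  define C where "C = (2 * pi) powr (k / 2) / sqrt (1 + c * k)"
  have ck: "1 + c * k > 0" using assms by (simp add: k_def add_pos_nonneg)
  have c': "c' \<ge> 0" using assms ck by (simp add: c'_def)
  have C: "C \<ge> 0" using ck by (simp add: C_def)
  have upd: "(\<Sum>j\<in>I. g ((x(i := y)) j)) = (\<Sum>j\<in>I. g (x j))"
    for g :: "real \<Rightarrow> real" and x y using I by (intro sum.cong) auto
  have "(\<integral>\<^sup>+v. ennreal (exp (- (\<Sum>i\<in>insert i I. (v i)\<^sup>2) / 2 - c / 2 * ((\<Sum>i\<in>insert i I. v i) + b)\<^sup>2))
            \<partial>PiM (insert i I) (\<lambda>_::nat. lborel)) =
    (\<integral>\<^sup>+y. \<integral>\<^sup>+v. ennreal (exp (- y\<^sup>2 / 2)) *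
          ennreal (exp (- (\<Sum>i\<in>I. (v i)\<^sup>2) / 2 - c / 2 * ((\<Sum>i\<in>I. v i) + (y + b))\<^sup>2))
            \<partial>PiM I (\<lambda>_::nat. lborel) \<partial>lborel)"
    using I
    by (subst lborel_family.product_nn_integral_insert_rev)
      (auto simp: upd[of "\<lambda>x. x\<^sup>2", simplified] upd[of "\<lambda>x. x", simplified] ennreal_mult'[symmetric] 
        exp_add[symmetric] add_ac diff_divide_distrib intro!: nn_integral_cong)
  also have "\<dots> = (\<integral>\<^sup>+y. ennreal (exp (- y\<^sup>2 / 2)) *
      ennreal (C * exp (- (c / (2 * (1 + c * k))) * (y + b)\<^sup>2)) \<partial>lborel)"
    unfolding k_def C_def
    by (intro nn_integral_cong, subst nn_integral_cmult, measurable, subst insert.IH)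
      (simp add: field_simps)
  also have "\<dots> = (\<integral>\<^sup>+y. ennreal C * ennreal (exp (- y\<^sup>2 / 2 - c' / 2 * (y + b)\<^sup>2)) \<partial>lborel)"
  proof (intro nn_integral_cong)
    fix y
    have e: "c / (2 * (1 + c * k)) = c' / 2" unfolding c'_def by simp
    have "exp (- y\<^sup>2 / 2) * (C * exp (- (c / (2 * (1 + c * k))) * (y + b)\<^sup>2)) =
        C * exp (- y\<^sup>2 / 2 - c' / 2 * (y + b)\<^sup>2)"
      unfolding e by (simp add: mult_exp_exp)
    then show "ennreal (exp (- y\<^sup>2 / 2)) * ennreal (C * exp (- (c / (2 * (1 + c * k))) * (y + b)\<^sup>2)) =
        ennreal C * ennreal (exp (- y\<^sup>2 / 2 - c' / 2 * (y + b)\<^sup>2))"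
      using C by (simp only: ennreal_mult'[symmetric] exp_ge_zero)
  qed
  also have "\<dots> = ennreal C * ennreal (sqrt (2 * pi / (1 + c')) * exp (- (c' / (2 * (1 + c'))) * b\<^sup>2))"
    by (subst nn_integral_cmult, measurable, subst nn_integral_gaussian[OF c'], rule refl)
  also have "\<dots> = ennreal (C * sqrt (2 * pi / (1 + c')) * exp (- (c' / (2 * (1 + c'))) * b\<^sup>2))"
    using C by (simp add: ennreal_mult' mult.assoc)
  also have "c' / (2 * (1 + c')) = c / (2 * (1 + c * (k + 1)))"
  proof -
    have "1 + c' = (1 + c * (k + 1)) / (1 + c * k)" using ck by (simp add: c'_def field_simps)
    then show ?thesis unfolding c'_def using ck by simp
  qed
  also have "C * sqrt (2 * pi / (1 + c')) = (2 * pi) powr ((k + 1) / 2) / sqrt (1 + c * (k + 1))"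
  proof -
    have 1: "(1 + c * k) * (1 + c') = 1 + c * (k + 1)" using ck by (simp add: c'_def field_simps)
    have 2: "(2 * pi) powr ((k + 1) / 2) = (2 * pi) powr (k / 2) * sqrt (2 * pi)"
      by (simp add: add_divide_distrib powr_add powr_half_sqrt)
    show ?thesis unfolding 1[symmetric] 2 C_def by (simp add: real_sqrt_mult real_sqrt_divide)
  qed
  finally show ?case using I by (simp add: k_def add_ac)
qed

section \<open>Laplace's method\<close>

text \<open>The phase of all Laplace integrals below, with minimum 0 at u = 0 and curvature 1. The
  linear term is supplied by the power of t in the Gamma integral, and cancels over the m deviations
  in the weight.\<close>

definition gap :: "real \<Rightarrow> real" where "gap u = exp u - 1 - u"

lemma gap_nonneg: "gap u \<ge> 0"
  unfolding gap_def using exp_ge_add_one_self[of u] by linarith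

lemma borel_measurable_gap [measurable]: "gap \<in> borel_measurable borel"
  unfolding gap_def by measurable

text \<open>Convexity: the tangent at w has slope exp w - 1.\<close>

lemma gap_ge_tangent: "gap u \<ge> gap w + (exp w - 1) * (u - w)"
  using mult_left_mono[OF exp_ge_add_one_self[of "u - w"], of "exp w"]
  unfolding gap_def by (simp add: mult_exp_exp algebra_simps)

text \<open>The dominating function for the Laplace integrals; the tangents at \<open>\<plusminus> 1 / sqrt n\<close> give a bound
  independent of \<open>n\<close>.\<close>

lemma gap_lower_bound:
  assumes "n \<ge> 1"
  shows "n * gap (v / sqrt n) \<ge> (\<bar>v\<bar> - 1) / 2"
proof (cases "\<bar>v\<bar> \<le> 1")
  case True
  have "n * gap (v / sqrt n) \<ge> 0" using assms gap_nonneg by simp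
  moreover have "(\<bar>v\<bar> - 1) / 2 \<le> 0" using True by simp
  ultimately show ?thesis by linarith
next
  case False
  define e where "e = 1 / sqrt n"
  have e: "0 < e" "e \<le> 1" "n * (e * e) = 1" using assms by (auto simp: e_def)
  have v: "v / sqrt n = v * e" by (simp add: e_def)
  \<comment> \<open>The tangent at e or -e, on the side of v, has slope at least e / 2 in absolute
    value; the nonnegative value of \<open>gap\<close> at the point of tangency is dropped.\<close>
  have key: "gap (v * e) \<ge> e / 2 * (e * (\<bar>v\<bar> - 1))"
  proof (cases "v \<ge> 0")
    case True
    have "e / 2 \<le> exp e - 1" using exp_ge_add_one_self[of e] e by linarith
    then have "e / 2 * (e * (v - 1)) \<le> (exp e - 1) * (e * (v - 1))"
      using False True e by (intro mult_right_mono) auto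
    also have "\<dots> \<le> gap (v * e)"
      using gap_ge_tangent[of e "v * e"] gap_nonneg[of e] by (simp add: algebra_simps)
    finally show ?thesis using True by simp
  next
    case neg: False
    have "exp (- e) \<le> 1 / (1 + e)"
      using exp_ge_add_one_self[of e] e by (simp add: exp_minus field_simps)
    \<comment> \<open>Equivalent to e^2 \<le> e; here n \<ge> 1 enters through e \<le> 1.\<close>
    also have "\<dots> \<le> 1 - e / 2" using e by (simp add: field_simps power2_eq_square mult_left_le)
    finally have "e / 2 \<le> 1 - exp (- e)" by simp
    then have "e / 2 * (e * (\<bar>v\<bar> - 1)) \<le> (1 - exp (- e)) * (e * (\<bar>v\<bar> - 1))"
      using False e by (intro mult_right_mono) auto
    also have "\<dots> \<le> gap (v * e)"
      using gap_ge_tangent[of "- e" "v * e"] gap_nonneg[of "- e"] neg by (simp add: algebra_simps)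
    finally show ?thesis .
  qed
  have "(\<bar>v\<bar> - 1) / 2 = (n * (e * e)) * (\<bar>v\<bar> - 1) / 2" using e by simp
  also have "\<dots> = n * (e / 2 * (e * (\<bar>v\<bar> - 1)))" by simp
  also have "\<dots> \<le> n * gap (v * e)" using key assms by (intro mult_left_mono) auto
  finally show ?thesis unfolding v .
qed

lemma gap_limit: "((\<lambda>n. n * gap (v / sqrt n)) \<longlongrightarrow> v\<^sup>2 / 2) at_top"
proof -
  consider "v = 0" | "v > 0" | "v < 0" by linarith
  then show ?thesis
  proof cases
    case 1
    then show ?thesis by (simp add: gap_def)
  next
    case 2
    then show ?thesis unfolding gap_def power2_eq_square by real_asymp
  next
    case 3
    then show ?thesis unfolding gap_def power2_eq_square by real_asymp
  qed
qed

text \<open>The exponential density plus its mirror image, divided by c, is an integrable majorant;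
  it exceeds the function only at 0, where both halves count.\<close>

lemma integrable_exp_abs:
  fixes c :: real
  assumes "c > 0"
  shows "integrable lborel (\<lambda>x. exp (- c * \<bar>x\<bar>))"
proof -
  let ?d = "exponential_density c"
  have d: "integrable lborel ?d"
  proof (rule integrableI_nonneg)
    interpret prob_space "density lborel ?d"
      by (rule prob_space_exponential_density[OF assms])
    show "(\<integral>\<^sup>+x. ennreal (?d x) \<partial>lborel) < \<infinity>"
      using emeasure_space_1 by (simp add: emeasure_density)
  qed (use assms in \<open>auto simp: exponential_density_def\<close>)
  then have "integrable lborel (\<lambda>x. ?d (0 + (-1) * x))"
    by (rule lborel_integrable_real_affine) simp
  with d have "integrable lborel (\<lambda>x. 1 / c * (?d x + ?d (- x)))" by simp
  then show ?thesis
    by (rule Bochner_Integration.integrable_bound)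
      (use assms in \<open>auto simp: exponential_density_def intro!: AE_I2\<close>)
qed

text \<open>The factor \<open>c\<close> is 1 for the weight, where the gap of minus the sum comes from the last radius,
  and 0 for the Gamma function.\<close>

lemma laplace_PiM:
  fixes b :: "nat \<Rightarrow> real"
  assumes I: "finite I" and c: "c \<ge> 0"
  shows "((\<lambda>n. \<integral>v. exp (- (\<Sum>i\<in>I. n * gap (v i / sqrt n)) - c * (n * gap (- (\<Sum>i\<in>I. v i) / sqrt n))
              + (\<Sum>i\<in>I. b i * (v i / sqrt n))) \<partial>PiM I (\<lambda>_. lborel))
          \<longlongrightarrow> (2 * pi) powr (real (card I) / 2) / sqrt (1 + c * real (card I))) at_top"
proof -
  let ?M = "PiM I (\<lambda>_::nat. lborel :: real measure)"
  let ?s = "\<lambda>n v. exp (- (\<Sum>i\<in>I. n * gap (v i / sqrt n)) - c * (n * gap (- (\<Sum>i\<in>I. v i) / sqrt n))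
              + (\<Sum>i\<in>I. b i * (v i / sqrt n)))"
  let ?f = "\<lambda>v. exp (- (\<Sum>i\<in>I. (v i)\<^sup>2) / 2 - c / 2 * ((\<Sum>i\<in>I. v i) + 0)\<^sup>2)"
  \<comment> \<open>\<open>gap_lower_bound\<close> alone gives exp (1/2 - |v| / 2) per coordinate;
    half of that decay is given up to absorb the linear term with coefficient
    \<open>b i\<close>.\<close>
  define w where "w v = (\<Prod>i\<in>I. exp (1 / 2) * exp (- (1 / 4) * \<bar>v i\<bar>))" for v :: "nat \<Rightarrow> real"
  \<comment> \<open>For n \<ge> \<open>?B\<close> every |b i| / sqrt n is at most 1/4.\<close>
  let ?B = "16 * (\<Sum>i\<in>I. (b i)\<^sup>2)"
  have "((\<lambda>n. integral\<^sup>L ?M (?s n)) \<longlongrightarrow> integral\<^sup>L ?M ?f) at_top"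
  proof (rule integral_dominated_convergence_at_top[where w = w])
    show "integrable ?M w" unfolding w_def using integrable_exp_abs[of "1 / 4"]
      by (intro lborel_family.product_integrable_prod I) auto
    show "AE v in ?M. ((\<lambda>n. ?s n v) \<longlongrightarrow> ?f v) at_top"
    proof (rule AE_I2)
      fix v :: "nat \<Rightarrow> real"
      have 0: "((\<lambda>n. x / sqrt n) \<longlongrightarrow> 0) at_top" for x :: real by real_asymp
      have "((\<lambda>n. ?s n v) \<longlongrightarrow> exp (- (\<Sum>i\<in>I. (v i)\<^sup>2 / 2) - c * ((- (\<Sum>i\<in>I. v i))\<^sup>2 / 2)
              + (\<Sum>i\<in>I. b i * 0))) at_top"
        by (intro tendsto_intros gap_limit 0)
      then show "((\<lambda>n. ?s n v) \<longlongrightarrow> ?f v) at_top" by (simp add: sum_divide_distrib)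
    qed
    show "\<forall>\<^sub>F n in at_top. AE v in ?M. norm (?s n v) \<le> w v"
      using eventually_ge_at_top[of "max 1 ?B"]
    proof eventually_elim
      case (elim n)
      then have n: "n \<ge> 1" "n \<ge> ?B" by auto
      have "- (n * gap (v i / sqrt n)) + b i * (v i / sqrt n) \<le> 1 / 2 + - (1 / 4) * \<bar>v i\<bar>"
        if i: "i \<in> I" for i and v :: "nat \<Rightarrow> real"
      proof -
        have "(b i)\<^sup>2 \<le> (\<Sum>i\<in>I. (b i)\<^sup>2)" using i I by (intro member_le_sum) auto
        then have "16 * (b i)\<^sup>2 \<le> n" using n by linarith
        then have "sqrt (16 * (b i)\<^sup>2) \<le> sqrt n" by simp
        then have "\<bar>b i\<bar> / sqrt n \<le> 1 / 4" using n by (simp add: real_sqrt_mult field_simps)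
        then have "\<bar>b i\<bar> / sqrt n * \<bar>v i\<bar> \<le> 1 / 4 * \<bar>v i\<bar>" by (rule mult_right_mono) simp
        moreover have "b i * (v i / sqrt n) \<le> \<bar>b i\<bar> / sqrt n * \<bar>v i\<bar>"
          using abs_ge_self[of "b i * (v i / sqrt n)"] n by (simp add: abs_mult)
        ultimately have "b i * (v i / sqrt n) \<le> 1 / 4 * \<bar>v i\<bar>" by linarith
        moreover have "- (n * gap (v i / sqrt n)) \<le> 1 / 2 - 1 / 2 * \<bar>v i\<bar>"
          using gap_lower_bound[OF n(1), of "v i"] by (simp add: field_simps)
        ultimately show ?thesis by linarith
      qed
      then have le: "(\<Sum>i\<in>I. - (n * gap (v i / sqrt n)) + b i * (v i / sqrt n)) \<le>
          (\<Sum>i\<in>I. 1 / 2 + - (1 / 4) * \<bar>v i\<bar>)" for v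
        by (intro sum_mono)
      show "AE v in ?M. norm (?s n v) \<le> w v"
      proof (rule AE_I2)
        fix v :: "nat \<Rightarrow> real"
        \<comment> \<open>The coupling term only makes the integrand smaller, so the bound can be a
          product over the coordinates.\<close>
        have "c * (n * gap (- (\<Sum>i\<in>I. v i) / sqrt n)) \<ge> 0" using c n gap_nonneg by simp
        then have "?s n v \<le> exp (\<Sum>i\<in>I. 1 / 2 + - (1 / 4) * \<bar>v i\<bar>)"
          using le[of v] by (simp add: sum.distrib sum_negf sum_subtractf)
        also have "\<dots> = w v" unfolding w_def by (simp only: exp_sum[OF I] exp_add)
        finally show "norm (?s n v) \<le> w v" by simp
      qed
    qed
  qed (use I in measurable)
  also have "integral\<^sup>L ?M ?f = (2 * pi) powr (real (card I) / 2) / sqrt (1 + c * real (card I))"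
  proof -
    have "integral\<^sup>L ?M ?f = enn2real (\<integral>\<^sup>+v. ennreal (?f v) \<partial>?M)"
      by (rule integral_eq_nn_integral) auto
    then show ?thesis unfolding nn_integral_PiM_gaussian[OF I c] using c by simp
  qed
  finally show ?thesis .
qed

section \<open>Stirling's formula\<close>

text \<open>The ratio of Gamma \<beta> to \<beta>^(\<beta> - 1/2) exp (-\<beta>), written as a
  Laplace integral; its convergence to sqrt (2 pi) is Stirling's formula.\<close>

definition stirling_int :: "real \<Rightarrow> real" where
  "stirling_int \<beta> = (\<integral>v. exp (- (\<beta> * gap (v / sqrt \<beta>))) \<partial>lborel)"

lemma stirling_int_tendsto: "(stirling_int \<longlongrightarrow> sqrt (2 * pi)) at_top"
proof -
  have "(\<integral>v. exp (- (n * gap (v 0 / sqrt n))) \<partial>PiM {0::nat} (\<lambda>_. lborel)) = stirling_int n" for n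
    unfolding stirling_int_def
    by (rule lborel_family.product_integral_singleton[where f = "\<lambda>v. exp (- (n * gap (v / sqrt n)))"]) measurable
  then show ?thesis
    using laplace_PiM[of "{0}" 0 "\<lambda>_. 0"] by (simp add: powr_half_sqrt)
qed

text \<open>Put t = \<beta> exp (v / sqrt \<beta>) in Euler's integral: t = \<beta> is the maximum
  of t^\<beta> exp (-t), the integrand with respect to dt / t.\<close>

lemma Gamma_eq_stirling_int:
  assumes "\<beta> > 0"
  shows "Gamma \<beta> = \<beta> powr (\<beta> - 1 / 2) * exp (- \<beta>) * stirling_int \<beta>"
proof -
  define K where "K = \<beta> powr (\<beta> - 1 / 2) * exp (- \<beta>)"
  have K: "K > 0" using assms by (simp add: K_def)
  have *: "(\<beta> * exp (1 / sqrt \<beta> * v)) powr (\<beta> - 1) / exp (\<beta> * exp (1 / sqrt \<beta> * v)) *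
      (\<beta> * (1 / sqrt \<beta>) * exp (1 / sqrt \<beta> * v)) = K * exp (- (\<beta> * gap (v / sqrt \<beta>)))" for v
  proof -
    define u where "u = v / sqrt \<beta>"
    have u: "1 / sqrt \<beta> * v = u" by (simp add: u_def)
    have "\<beta> * (1 / sqrt \<beta>) = exp (ln \<beta> / 2)"
      using assms by (simp add: real_div_sqrt ln_sqrt[symmetric])
    moreover have "(\<beta> * exp u) powr (\<beta> - 1) = exp ((\<beta> - 1) * (ln \<beta> + u))"
      using assms by (simp add: powr_def ln_mult)
    moreover have "K = exp ((\<beta> - 1 / 2) * ln \<beta> - \<beta>)"
      using assms by (simp add: K_def powr_def mult_exp_exp)
    ultimately show ?thesis
      unfolding u u_def[symmetric] gap_def
      by (simp only: mult_exp_exp exp_diff[symmetric], intro arg_cong[where f = exp])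
        (simp add: field_simps)
  qed
  have "ennreal (Gamma \<beta>) = (\<integral>\<^sup>+t. ennreal (t powr (\<beta> - 1) / exp t) * indicator {0<..} t \<partial>lborel)"
    unfolding Gamma_conv_nn_integral_real[OF assms]
    by (intro nn_integral_cong) (auto simp: indicator_def)
  also have "\<dots> = (\<integral>\<^sup>+v. ennreal (K * exp (- (\<beta> * gap (v / sqrt \<beta>)))) \<partial>lborel)"
  proof (subst nn_integral_exp_substitution[where A = \<beta> and B = "1 / sqrt \<beta>"])
    show "(\<integral>\<^sup>+v. ennreal ((\<beta> * exp (1 / sqrt \<beta> * v)) powr (\<beta> - 1) / exp (\<beta> * exp (1 / sqrt \<beta> * v))) *
        ennreal (\<beta> * (1 / sqrt \<beta>) * exp (1 / sqrt \<beta> * v)) \<partial>lborel) =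
      (\<integral>\<^sup>+v. ennreal (K * exp (- (\<beta> * gap (v / sqrt \<beta>)))) \<partial>lborel)"
      unfolding *[symmetric] using assms
      by (intro nn_integral_cong ennreal_mult'[symmetric]) auto
  qed (use assms in auto)
  finally have "Gamma \<beta> = enn2real \<dots>" using assms by (metis Gamma_real_pos enn2real_ennreal less_imp_le)
  also have "\<dots> = (\<integral>v. K * exp (- (\<beta> * gap (v / sqrt \<beta>))) \<partial>lborel)"
    using K by (subst integral_eq_nn_integral) auto
  also have "\<dots> = K * stirling_int \<beta>" unfolding stirling_int_def by simp
  finally show ?thesis by (simp add: K_def)
qed

lemma stirling_int_pos:
  assumes "\<beta> > 0"
  shows "stirling_int \<beta> > 0"
proof -
  have "0 < \<beta> powr (\<beta> - 1 / 2) * exp (- \<beta>) * stirling_int \<beta>"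
    using Gamma_real_pos[OF assms] unfolding Gamma_eq_stirling_int[OF assms] .
  moreover have "0 < \<beta> powr (\<beta> - 1 / 2) * exp (- \<beta>)" using assms by simp
  ultimately show ?thesis by (rule zero_less_mult_pos)
qed

section \<open>Generalised Poisson weights: local limit and Gaussian bound\<close>

text \<open>For \<open>a = 0\<close> these are the Poisson weights of mean \<open>n\<close>.\<close>

definition gpois :: "real \<Rightarrow> nat \<Rightarrow> real \<Rightarrow> real" where
  "gpois a l n = n powr (a + real l) * exp (- n) / Gamma (a + real l + 1)"

text \<open>The Kullback-Leibler divergence of the Poisson law of mean \<beta> from the Poisson law
  of mean n.\<close>

definition rel_entropy :: "real \<Rightarrow> real \<Rightarrow> real" where
  "rel_entropy \<beta> n = \<beta> * ln (\<beta> / n) - \<beta> + n"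

text \<open>An exact identity, obtained by inserting \<open>Gamma_eq_stirling_int\<close>. Both the
  pointwise limit and the uniform bound for the weights are read off from its three factors.\<close>

lemma sqrt_gpois_eq:
  assumes "n > 0" "a > -1" and \<beta>: "\<beta> = a + real l + 1"
  shows "sqrt n * gpois a l n = sqrt (\<beta> / n) * exp (- rel_entropy \<beta> n) / stirling_int \<beta>"
proof -
  have b: "\<beta> > 0" using assms by simp
  have l: "a + real l = \<beta> - 1" "a + real l + 1 = \<beta>" using \<beta> by auto
  have s: "sqrt n = exp (ln n / 2)" "sqrt (\<beta> / n) = exp ((ln \<beta> - ln n) / 2)"
  proof -
    have "sqrt (\<beta> / n) = exp (ln (sqrt (\<beta> / n)))" using assms(1) b by simp
    also have "ln (sqrt (\<beta> / n)) = (ln \<beta> - ln n) / 2" using assms(1) b by (simp add: ln_sqrt ln_div)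
    finally show "sqrt (\<beta> / n) = exp ((ln \<beta> - ln n) / 2)" .
  qed (use assms(1) in \<open>simp add: ln_sqrt[symmetric]\<close>)
  have e: "\<beta> powr (\<beta> - 1 / 2) * exp (- \<beta>) = exp ((\<beta> - 1 / 2) * ln \<beta> - \<beta>)"
    using b by (simp add: powr_def mult_exp_exp)
  have e2: "n powr (\<beta> - 1) = exp ((\<beta> - 1) * ln n)" using assms(1) by (simp add: powr_def)
  have "sqrt n * gpois a l n = exp (ln n / 2 + (\<beta> - 1) * ln n - n - ((\<beta> - 1 / 2) * ln \<beta> - \<beta>)) / stirling_int \<beta>"
  proof -
    have *: "exp A * (exp B * exp (- n) / (exp D * S)) = exp (A + B - n - D) / S" for A B D S
      by (simp add: exp_add exp_diff exp_minus field_simps)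
    show ?thesis unfolding gpois_def l(2) unfolding l(1) Gamma_eq_stirling_int[OF b] e e2 s(1) *
      by (rule refl)
  qed
  also have "ln n / 2 + (\<beta> - 1) * ln n - n - ((\<beta> - 1 / 2) * ln \<beta> - \<beta>) =
      (ln \<beta> - ln n) / 2 + - rel_entropy \<beta> n"
    using assms(1) b by (simp add: rel_entropy_def ln_div field_simps)
  finally show ?thesis unfolding s(2) exp_add by simp
qed

text \<open>The Hellinger bound needs no case distinction between small and large \<open>\<beta>\<close> and, for
  \<open>\<beta> = O(n)\<close>, already gives Gaussian decay on the scale \<open>sqrt n\<close>.\<close>

lemma rel_entropy_ge:
  assumes "\<beta> > 0" "n > 0"
  shows "rel_entropy \<beta> n \<ge> (sqrt \<beta> - sqrt n)\<^sup>2"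
proof -
  \<comment> \<open>The inequality ln x \<le> x - 1 is used at the square root; at n / \<beta>
    itself it would yield no more than nonnegativity.\<close>
  have "ln (n / \<beta>) / 2 = ln (sqrt (n / \<beta>))" using assms by (simp add: ln_sqrt)
  also have "\<dots> \<le> sqrt (n / \<beta>) - 1" using assms by (intro ln_le_minus_one) simp
  also have "sqrt (n / \<beta>) = sqrt n / sqrt \<beta>" by (rule real_sqrt_divide)
  finally have "2 - 2 * (sqrt n / sqrt \<beta>) \<le> ln (\<beta> / n)"
    using assms by (simp add: ln_div)
  then have "\<beta> * (2 - 2 * (sqrt n / sqrt \<beta>)) \<le> \<beta> * ln (\<beta> / n)" using assms by (intro mult_left_mono) auto
  moreover have "\<beta> * (2 - 2 * (sqrt n / sqrt \<beta>)) = 2 * \<beta> - 2 * (sqrt \<beta> * sqrt n)"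
    using assms by (simp add: field_simps flip: power2_eq_square)
  moreover have "(sqrt \<beta> - sqrt n)\<^sup>2 = \<beta> + n - 2 * (sqrt \<beta> * sqrt n)"
    using assms by (simp add: power2_diff)
  ultimately show ?thesis unfolding rel_entropy_def by linarith
qed

text \<open>With h = (\<beta> - n) / n the entropy is n ((1 + h) ln (1 + h) - h), that is, (\<beta>
  - n)^2 / n times a function of h that tends to 1/2 as h tends to 0.\<close>

lemma rel_entropy_tendsto:
  assumes n: "filterlim n at_top F" and lim: "((\<lambda>x. (\<beta> x - n x) / sqrt (n x)) \<longlongrightarrow> t) F"
  shows "((\<lambda>x. rel_entropy (\<beta> x) (n x)) \<longlongrightarrow> t\<^sup>2 / 2) F"
proof -
  \<comment> \<open>The singularity at h = 0 is filled in, since \<beta> = n may well occur along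
    the filter.\<close>
  define \<psi> :: "real \<Rightarrow> real" where
    "\<psi> h = (if h = 0 then 1 / 2 else ((1 + h) * ln (1 + h) - h) / h\<^sup>2)" for h
  have "((\<lambda>h::real. ((1 + h) * ln (1 + h) - h) / h\<^sup>2) \<longlongrightarrow> 1 / 2) (at 0)" by real_asymp
  then have "(\<psi> \<longlongrightarrow> 1 / 2) (at 0)"
    by (rule Lim_transform_eventually) (auto simp: \<psi>_def eventually_at_filter)
  then have cont: "isCont \<psi> 0" by (simp add: isCont_def \<psi>_def)
  let ?\<delta> = "\<lambda>x. (\<beta> x - n x) / sqrt (n x)"
  have s: "((\<lambda>x. inverse (sqrt (n x))) \<longlongrightarrow> 0) F"
    by (intro tendsto_inverse_0_at_top filterlim_compose[OF sqrt_at_top n])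
  have "((\<lambda>x. ?\<delta> x * inverse (sqrt (n x))) \<longlongrightarrow> t * 0) F"
    by (intro tendsto_intros lim s)
  then have "((\<lambda>x. \<psi> (?\<delta> x * inverse (sqrt (n x)))) \<longlongrightarrow> \<psi> 0) F"
    using isCont_tendsto_compose[OF cont] by simp
  then have "((\<lambda>x. (?\<delta> x)\<^sup>2 * \<psi> (?\<delta> x * inverse (sqrt (n x)))) \<longlongrightarrow> t\<^sup>2 * \<psi> 0) F"
    by (intro tendsto_intros lim)
  moreover have "\<forall>\<^sub>F x in F. (?\<delta> x)\<^sup>2 * \<psi> (?\<delta> x * inverse (sqrt (n x))) = rel_entropy (\<beta> x) (n x)"
    using filterlim_at_top_dense[THEN iffD1, OF n, rule_format, of 0]
  proof eventually_elim
    case (elim x)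
    define h where "h = (\<beta> x - n x) / n x"
    have h: "?\<delta> x * inverse (sqrt (n x)) = h" "(?\<delta> x)\<^sup>2 = n x * h\<^sup>2" "\<beta> x / n x = 1 + h" "\<beta> x = n x * (1 + h)"
      using elim by (auto simp: h_def field_simps power2_eq_square)
    have "rel_entropy (\<beta> x) (n x) = n x * ((1 + h) * ln (1 + h) - h)"
      unfolding rel_entropy_def h(3) by (simp add: h(4) algebra_simps)
    then show ?case unfolding h(1,2) \<psi>_def by auto
  qed
  ultimately show ?thesis by (subst (asm) tendsto_cong) (simp_all add: \<psi>_def)
qed

text \<open>The floor and the offset a + 1 move \<beta> away from n + t sqrt n by a bounded amount,
  which is negligible on the scale sqrt n.\<close>

lemma floor_param:
  fixes a n t :: real
  assumes "n > 0" "n + t * sqrt n \<ge> 0" and \<beta>: "\<beta> = a + real (nat \<lfloor>n + t * sqrt n\<rfloor>) + 1"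
  shows "\<bar>(\<beta> - n) / sqrt n - t\<bar> \<le> (\<bar>a\<bar> + 1) / sqrt n"
proof -
  have "real (nat \<lfloor>n + t * sqrt n\<rfloor>) = of_int \<lfloor>n + t * sqrt n\<rfloor>" using assms by simp
  then have "\<bar>\<beta> - n - t * sqrt n\<bar> \<le> \<bar>a\<bar> + 1" unfolding \<beta> by linarith
  then have "\<bar>\<beta> - n - t * sqrt n\<bar> / sqrt n \<le> (\<bar>a\<bar> + 1) / sqrt n"
    using assms by (intro divide_right_mono) auto
  moreover have "(\<beta> - n) / sqrt n - t = (\<beta> - n - t * sqrt n) / sqrt n"
    using assms by (simp add: field_simps)
  ultimately show ?thesis using assms by simp
qed

text \<open>A local central limit theorem: in \<open>sqrt_gpois_eq\<close> the ratio \<beta> / n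
  tends to 1, the entropy to t^2 / 2 and the Stirling factor to sqrt (2 pi).\<close>

lemma gpois_local_limit:
  assumes a: "a > -1"
  shows "((\<lambda>n. sqrt n * gpois a (nat \<lfloor>n + t * sqrt n\<rfloor>) n) \<longlongrightarrow> exp (- t\<^sup>2 / 2) / sqrt (2 * pi)) at_top"
proof -
  define \<beta> where "\<beta> n = a + real (nat \<lfloor>n + t * sqrt n\<rfloor>) + 1" for n
  let ?\<delta> = "\<lambda>n. (\<beta> n - n) / sqrt n"
  have "filterlim (\<lambda>n. n + t * sqrt n) at_top at_top" by real_asymp
  then have ev: "\<forall>\<^sub>F n in at_top. n + t * sqrt n \<ge> 0" by (simp add: filterlim_at_top)
  have "((\<lambda>n. ?\<delta> n - t) \<longlongrightarrow> 0) at_top"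
  proof (rule Lim_null_comparison)
    show "((\<lambda>n. (\<bar>a\<bar> + 1) / sqrt n) \<longlongrightarrow> 0) at_top"
      unfolding divide_inverse
      by (rule tendsto_mult_right_zero) (intro tendsto_inverse_0_at_top sqrt_at_top)
    show "\<forall>\<^sub>F n in at_top. norm (?\<delta> n - t) \<le> (\<bar>a\<bar> + 1) / sqrt n"
      using ev eventually_gt_at_top[of 0]
      by eventually_elim (simp only: real_norm_def, rule floor_param, auto simp: \<beta>_def)
  qed
  then have \<delta>: "(?\<delta> \<longlongrightarrow> t) at_top" by (rule LIM_zero_cancel)
  have ent: "((\<lambda>n. rel_entropy (\<beta> n) n) \<longlongrightarrow> t\<^sup>2 / 2) at_top"
    by (rule rel_entropy_tendsto[OF filterlim_ident \<delta>])
  have s: "((\<lambda>n::real. inverse (sqrt n)) \<longlongrightarrow> 0) at_top"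
    by (intro tendsto_inverse_0_at_top sqrt_at_top)
  have "((\<lambda>n. 1 + ?\<delta> n * inverse (sqrt n)) \<longlongrightarrow> 1 + t * 0) at_top"
    by (intro tendsto_intros \<delta> s)
  moreover have "\<forall>\<^sub>F n in at_top. 1 + ?\<delta> n * inverse (sqrt n) = \<beta> n / n"
    using eventually_gt_at_top[of 0] by eventually_elim (simp add: field_simps)
  ultimately have ratio: "((\<lambda>n. \<beta> n / n) \<longlongrightarrow> 1) at_top"
    by (subst (asm) tendsto_cong) simp_all
  have "filterlim (\<lambda>n. \<beta> n / n * n) at_top at_top"
    by (rule filterlim_tendsto_pos_mult_at_top[OF ratio _ filterlim_ident]) simp
  moreover have "\<forall>\<^sub>F n in at_top. \<beta> n / n * n = \<beta> n"
    using eventually_gt_at_top[of 0] by eventually_elim simp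
  ultimately have "filterlim \<beta> at_top at_top" by (subst (asm) filterlim_cong) simp_all
  then have st: "((\<lambda>n. stirling_int (\<beta> n)) \<longlongrightarrow> sqrt (2 * pi)) at_top"
    by (rule filterlim_compose[OF stirling_int_tendsto])
  have "((\<lambda>n. sqrt (\<beta> n / n) * exp (- rel_entropy (\<beta> n) n) / stirling_int (\<beta> n))
      \<longlongrightarrow> sqrt 1 * exp (- (t\<^sup>2 / 2)) / sqrt (2 * pi)) at_top"
    by (intro tendsto_intros ratio ent st) simp
  moreover have "\<forall>\<^sub>F n in at_top. sqrt (\<beta> n / n) * exp (- rel_entropy (\<beta> n) n) / stirling_int (\<beta> n) =
      sqrt n * gpois a (nat \<lfloor>n + t * sqrt n\<rfloor>) n"
    using eventually_gt_at_top[of 0]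
    by eventually_elim (rule sqrt_gpois_eq[symmetric], auto simp: a \<beta>_def)
  ultimately show ?thesis by (subst (asm) tendsto_cong) simp_all
qed

lemma gpois_nonneg:
  assumes "a > -1"
  shows "gpois a l n \<ge> 0"
  unfolding gpois_def using assms by (auto intro!: divide_nonneg_nonneg Gamma_real_nonneg)

text \<open>The majorant for dominated convergence. The restriction to l \<le> C n matters: far
  beyond n the upper tail of a Poisson law is heavier than Gaussian.\<close>

lemma gpois_gaussian_bound:
  assumes a: "a > -1" and C: "C \<ge> 0"
  obtains K c where "c > 0" "K \<ge> 0"
    "\<And>n t. n \<ge> 1 \<Longrightarrow> n + t * sqrt n \<ge> 0 \<Longrightarrow> n + t * sqrt n \<le> C * n \<Longrightarrow>
       sqrt n * gpois a (nat \<lfloor>n + t * sqrt n\<rfloor>) n \<le> K * exp (- c * t\<^sup>2)"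
proof -
  \<comment> \<open>A convergent sequence is bounded, so one constant \<kappa> bounds the reciprocal
    Stirling factors for all l, small ones included.\<close>
  have "filterlim (\<lambda>l. a + real l + 1) at_top sequentially" by real_asymp
  then have "(\<lambda>l. stirling_int (a + real l + 1)) \<longlonglongrightarrow> sqrt (2 * pi)"
    by (rule filterlim_compose[OF stirling_int_tendsto])
  then have "(\<lambda>l. inverse (stirling_int (a + real l + 1))) \<longlonglongrightarrow> inverse (sqrt (2 * pi))"
    by (intro tendsto_intros) auto
  then have "Bseq (\<lambda>l. inverse (stirling_int (a + real l + 1)))"
    by (intro convergent_imp_Bseq convergentI)
  then obtain \<kappa> where \<kappa>: "\<kappa> > 0" "\<And>l. \<bar>inverse (stirling_int (a + real l + 1))\<bar> \<le> \<kappa>"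
    by (auto simp: Bseq_def)
  \<comment> \<open>C' bounds \<beta> / n. Hence |\<beta> - n| \<le> |sqrt \<beta> - sqrt n| (sqrt
    C' + 1) sqrt n, which turns the Hellinger bound into 2 c \<delta>^2. The 2 in c is lost in t^2
    \<le> 2 \<delta>^2 + 2 (\<delta> - t)^2, and the exponential in K pays for the rounding error
    \<delta> - t.\<close>
  define C' where "C' = \<bar>a\<bar> + 1 + C"
  define c where "c = 1 / (2 * (sqrt C' + 1)\<^sup>2)"
  define K where "K = sqrt C' * exp (2 * c * (\<bar>a\<bar> + 1)\<^sup>2) * \<kappa>"
  have C': "C' > 0" using C by (simp add: C'_def)
  have C1: "sqrt C' + 1 > 0" using C' by (intro add_pos_pos) auto
  have c: "c > 0" unfolding c_def using C1 by simp
  have K: "K \<ge> 0" using C' \<kappa> by (simp add: K_def)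
  have "sqrt n * gpois a (nat \<lfloor>n + t * sqrt n\<rfloor>) n \<le> K * exp (- c * t\<^sup>2)"
    if n: "n \<ge> 1" "n + t * sqrt n \<ge> 0" "n + t * sqrt n \<le> C * n" for n t
  proof -
    define l where "l = nat \<lfloor>n + t * sqrt n\<rfloor>"
    define \<beta> where "\<beta> = a + real l + 1"
    define \<delta> where "\<delta> = (\<beta> - n) / sqrt n"
    have b: "\<beta> > 0" using a by (simp add: \<beta>_def)
    have "real l \<le> n + t * sqrt n" unfolding l_def using n by simp
    then have "\<beta> \<le> (\<bar>a\<bar> + 1) * 1 + C * n" unfolding \<beta>_def mult_1_right using n(3) abs_ge_self[of a] by linarith
    also have "\<dots> \<le> (\<bar>a\<bar> + 1) * n + C * n" using n by (intro add_right_mono mult_left_mono) auto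
    finally have bC: "\<beta> \<le> C' * n" by (simp add: C'_def algebra_simps)
    then have sb: "sqrt \<beta> \<le> sqrt C' * sqrt n" by (metis real_sqrt_le_mono real_sqrt_mult)
    have ratio: "sqrt (\<beta> / n) \<le> sqrt C'" using bC n by (simp add: field_simps)
    have "\<bar>\<delta> - t\<bar> \<le> (\<bar>a\<bar> + 1) / sqrt n"
      unfolding \<delta>_def by (rule floor_param) (use n in \<open>auto simp: \<beta>_def l_def\<close>)
    also have "\<dots> \<le> \<bar>a\<bar> + 1" using n by (simp add: divide_le_eq mult_le_cancel_left1)
    finally have "(\<delta> - t)\<^sup>2 \<le> (\<bar>a\<bar> + 1)\<^sup>2" by (simp add: abs_le_square_iff[symmetric])
    moreover have "t\<^sup>2 \<le> 2 * \<delta>\<^sup>2 + 2 * (\<delta> - t)\<^sup>2"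
      using zero_le_power2[of "2 * \<delta> - t"] by (simp add: power2_eq_square algebra_simps)
    ultimately have \<delta>: "\<delta>\<^sup>2 \<ge> t\<^sup>2 / 2 - (\<bar>a\<bar> + 1)\<^sup>2" by linarith
    have "\<bar>\<delta>\<bar> * sqrt n = \<bar>sqrt \<beta> - sqrt n\<bar> * (sqrt \<beta> + sqrt n)"
    proof -
      have "(sqrt \<beta> - sqrt n) * (sqrt \<beta> + sqrt n) = \<beta> - n" using b n by (simp add: algebra_simps)
      then have "\<bar>\<beta> - n\<bar> = \<bar>sqrt \<beta> - sqrt n\<bar> * \<bar>sqrt \<beta> + sqrt n\<bar>" by (metis abs_mult)
      then show ?thesis using b n by (simp add: \<delta>_def abs_of_pos add_pos_pos)
    qed
    also have "\<dots> \<le> \<bar>sqrt \<beta> - sqrt n\<bar> * ((sqrt C' + 1) * sqrt n)"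
      using sb by (intro mult_left_mono) (auto simp: algebra_simps)
    finally have "\<bar>\<delta>\<bar> \<le> \<bar>sqrt \<beta> - sqrt n\<bar> * (sqrt C' + 1)" using n by simp
    then have "\<delta>\<^sup>2 \<le> (sqrt \<beta> - sqrt n)\<^sup>2 * (sqrt C' + 1)\<^sup>2"
      using power_mono[of "\<bar>\<delta>\<bar>" _ 2] by (fastforce simp: power_mult_distrib)
    then have "2 * c * \<delta>\<^sup>2 \<le> (sqrt \<beta> - sqrt n)\<^sup>2"
      using C1 by (simp add: c_def divide_le_eq)
    also have "\<dots> \<le> rel_entropy \<beta> n" using n b by (intro rel_entropy_ge) auto
    finally have "2 * c * (t\<^sup>2 / 2 - (\<bar>a\<bar> + 1)\<^sup>2) \<le> rel_entropy \<beta> n"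
      using mult_left_mono[OF \<delta>, of "2 * c"] c by linarith
    then have "exp (- rel_entropy \<beta> n) \<le> exp (2 * c * (\<bar>a\<bar> + 1)\<^sup>2) * exp (- c * t\<^sup>2)"
      unfolding mult_exp_exp by (simp add: algebra_simps)
    moreover have "1 / stirling_int \<beta> \<le> \<kappa>"
      using \<kappa>(2)[of l] stirling_int_pos[OF b] by (simp add: \<beta>_def inverse_eq_divide)
    ultimately have "sqrt (\<beta> / n) * exp (- rel_entropy \<beta> n) * (1 / stirling_int \<beta>) \<le>
        sqrt C' * (exp (2 * c * (\<bar>a\<bar> + 1)\<^sup>2) * exp (- c * t\<^sup>2)) * \<kappa>"
      using ratio b n stirling_int_pos[OF b] C' by (intro mult_mono) auto
    then show ?thesis
      using sqrt_gpois_eq[of n a \<beta> l] n a unfolding l_def[symmetric] by (simp add: K_def \<beta>_def mult_ac)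
  qed
  with c K show ?thesis using that by blast
qed

section \<open>From the sum over l to a Gaussian integral\<close>

text \<open>The sum as the integral of a step function, so that its limit falls under dominated
  convergence.\<close>

lemma sum_eq_integral_floor:
  fixes F :: "nat \<Rightarrow> real"
  shows "(\<Sum>l<N. F l) = (\<integral>s. indicator {0..<real N} s * F (nat \<lfloor>s\<rfloor>) \<partial>lborel)"
proof -
  have "has_bochner_integral lborel (\<lambda>s. indicator {0..<real N} s * F (nat \<lfloor>s\<rfloor>)) (\<Sum>l<N. F l)"
  proof (induction N)
    case 0
    then show ?case by (simp add: has_bochner_integral_zero)
  next
    case (Suc N)
    have eq: "indicator {0..<real (Suc N)} s * F (nat \<lfloor>s\<rfloor>) =
        indicator {0..<real N} s * F (nat \<lfloor>s\<rfloor>) + indicator {real N..<real N + 1} s * F N" for s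
    proof (cases "s \<in> {real N..<real N + 1}")
      case True
      then have "\<lfloor>s\<rfloor> = int N" by (intro floor_unique) auto
      then show ?thesis using True by (auto simp: indicator_def)
    qed (auto simp: indicator_def)
    have "has_bochner_integral lborel (indicator {real N..<real N + 1})
        (measure lborel {real N..<real N + 1})"
      by (rule has_bochner_integral_real_indicator) auto
    then have "has_bochner_integral lborel (\<lambda>s. indicator {real N..<real N + 1} s * F N) (1 * F N)"
      by (intro has_bochner_integral_mult_left) auto
    from has_bochner_integral_add[OF Suc this] show ?case unfolding eq by simp
  qed
  then show ?thesis by (simp add: has_bochner_integral_integral_eq)
qed

lemma borel_measurable_gpois_floor [measurable]:
  "(\<lambda>t. gpois a (nat \<lfloor>n + t * sqrt n\<rfloor>) n) \<in> borel_measurable borel"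
proof -
  have "(\<lambda>l. gpois a (nat l) n) \<in> borel_measurable (count_space UNIV)" by simp
  then show ?thesis
    by (rule measurable_compose[rotated]) measurable
qed

lemma integral_exp_square:
  assumes "c > 0"
  shows "integrable lborel (\<lambda>t. exp (- c * t\<^sup>2))" and "(\<integral>t. exp (- c * t\<^sup>2) \<partial>lborel) = sqrt (pi / c)"
proof -
  define s where "s = sqrt (1 / (2 * c))"
  have s: "s > 0" "s\<^sup>2 = 1 / (2 * c)" using assms by (auto simp: s_def)
  have eq: "exp (- c * t\<^sup>2) = sqrt (pi / c) * normal_density 0 s t" for t
    unfolding normal_density_def s(2) using assms by simp
  show "integrable lborel (\<lambda>t. exp (- c * t\<^sup>2))" unfolding eq using s by simp
  show "(\<integral>t. exp (- c * t\<^sup>2) \<partial>lborel) = sqrt (pi / c)" unfolding eq using s by simp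
qed

lemma integral_exp_square_half:
  assumes "c > 0"
  shows "(\<integral>t. indicator {..<0} t * exp (- c * t\<^sup>2) \<partial>lborel) = sqrt (pi / c) / 2"
proof -
  let ?g = "\<lambda>t. exp (- c * t\<^sup>2)"
  note int = integral_exp_square(1)[OF assms]
  have i: "integrable lborel (\<lambda>t. indicator A t * ?g t)" if "A \<in> sets borel" for A
    using integrable_real_mult_indicator[OF _ int, of A] that by (simp add: mult.commute)
  have "(\<integral>t. indicator {..<0} t * ?g t \<partial>lborel) = (\<integral>t. indicator {0<..} t * ?g t \<partial>lborel)"
    by (subst lborel_integral_real_affine[where c = "-1" and t = 0])
      (auto intro!: Bochner_Integration.integral_cong simp: indicator_def)
  moreover have "(\<integral>t. ?g t \<partial>lborel) =
      (\<integral>t. indicator {..<0} t * ?g t + indicator {0<..} t * ?g t \<partial>lborel)"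
  proof (rule integral_cong_AE)
    show "AE t in lborel. ?g t = indicator {..<0} t * ?g t + indicator {0<..} t * ?g t"
      using AE_lborel_singleton[of "0::real"] by eventually_elim (auto simp: indicator_def)
  qed auto
  ultimately show ?thesis
    using integral_exp_square(2)[OF assms]
      Bochner_Integration.integral_add[OF i[of "{..<0}"] i[of "{0<..}"]] by simp
qed

text \<open>\<open>chi_disc\<close> as a function of y = |z|^(2/m), which lies on the same side of 1
  as |z|.\<close>

definition cutoff :: "real \<Rightarrow> real" where
  "cutoff y = (if y < 1 then 1 else if y = 1 then 1 / 2 else 0)"

text \<open>With n = N y the bound l < N reads t < r sqrt n for r = 1 / y - 1, so the sign of r
  decides. At r = 0 the half-line t < 0 remains, the origin of the value 1/2 on the unit
  circle.\<close>

lemma indicator_window_tendsto: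
  assumes y: "y > 0"
  defines "h \<equiv> (\<lambda>t::real. if y < 1 then 1 else if y = 1 then indicator {..<0} t else 0)"
  shows "((\<lambda>n. indicator {0..<n / y} (n + t * sqrt n)) \<longlongrightarrow> (h t :: real)) at_top"
proof (rule tendsto_eventually)
  define r where "r = 1 / y - 1"
  have div: "n / y = n + r * n" for n by (simp add: r_def algebra_simps)
  have "filterlim (\<lambda>n. n + t * sqrt n) at_top at_top" by real_asymp
  then have ev: "\<forall>\<^sub>F n in at_top. n + t * sqrt n \<ge> 0" by (simp add: filterlim_at_top)
  have large: "\<forall>\<^sub>F n in at_top. sqrt n > C" for C
    using sqrt_at_top by (simp add: filterlim_at_top_dense)
  consider "y < 1" | "y = 1" | "y > 1" by linarith
  then show "\<forall>\<^sub>F n in at_top. indicator {0..<n / y} (n + t * sqrt n) = h t"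
  proof cases
    case 1
    then have r: "r > 0" using y by (simp add: r_def)
    show ?thesis using ev large[of "t / r"] eventually_gt_at_top[of 0]
    proof eventually_elim
      case (elim n)
      then have "t < r * sqrt n" using r by (simp add: field_simps)
      then have "t * sqrt n < r * sqrt n * sqrt n" using elim by (intro mult_strict_right_mono) auto
      then show ?case using elim 1 unfolding div h_def by (simp add: mult.assoc)
    qed
  next
    case 2
    show ?thesis using ev eventually_gt_at_top[of 0]
      by eventually_elim (use 2 in \<open>auto simp: h_def indicator_def mult_less_0_iff\<close>)
  next
    case 3
    then have r: "- r > 0" using y by (simp add: r_def)
    show ?thesis using large[of "- t / (- r)"] eventually_gt_at_top[of 0]
    proof eventually_elim
      case (elim n)
      then have "- t < - r * sqrt n" using r by (simp add: field_simps)
      then have "- t * sqrt n < - r * sqrt n * sqrt n" using elim by (intro mult_strict_right_mono) auto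
      then show ?case using elim 3 unfolding div h_def by (simp add: mult.assoc indicator_def)
    qed
  qed
qed

text \<open>The m local limits multiply to exp (-m t^2 / 2) / (2 pi)^(m/2), whose integral over the
  whole line is (2 pi)^(-m/2) sqrt (2 pi / m).\<close>

lemma gpois_prod_integral_tendsto:
  assumes m: "m \<ge> 1" and a: "\<And>k. k \<in> {1..m} \<Longrightarrow> a k > -1" and y: "y > 0"
  shows "((\<lambda>n. \<integral>t. indicator {0..<n / y} (n + t * sqrt n) *
              (\<Prod>k=1..m. sqrt n * gpois (a k) (nat \<lfloor>n + t * sqrt n\<rfloor>) n) \<partial>lborel)
          \<longlongrightarrow> cutoff y / (sqrt (real m) * (2 * pi) powr (real (m - 1) / 2))) at_top"
proof -
  define h where "h t = (if y < 1 then 1 else if y = 1 then indicator {..<0} t else 0 :: real)" for t :: real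
  let ?s = "\<lambda>n t. indicator {0..<n / y} (n + t * sqrt n) *
              (\<Prod>k=1..m. sqrt n * gpois (a k) (nat \<lfloor>n + t * sqrt n\<rfloor>) n)"
  let ?f = "\<lambda>t. h t * (\<Prod>k=1..m. exp (- t\<^sup>2 / 2) / sqrt (2 * pi))"
  \<comment> \<open>The window forces n + t sqrt n < n / y, hence the choice C = 1 / y.\<close>
  have "\<exists>K c. c > 0 \<and> K \<ge> 0 \<and> (\<forall>n t. n \<ge> 1 \<longrightarrow> n + t * sqrt n \<ge> 0 \<longrightarrow> n + t * sqrt n \<le> 1 / y * n \<longrightarrow>
       sqrt n * gpois (a k) (nat \<lfloor>n + t * sqrt n\<rfloor>) n \<le> K * exp (- c * t\<^sup>2))" if "k \<in> {1..m}" for k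
    using gpois_gaussian_bound[OF a[OF that], of "1 / y"] y by (metis less_imp_le zero_le_divide_1_iff)
  then obtain K c where Kc: "\<And>k. k \<in> {1..m} \<Longrightarrow> c k > 0" "\<And>k. k \<in> {1..m} \<Longrightarrow> K k \<ge> 0"
    "\<And>k n t. k \<in> {1..m} \<Longrightarrow> n \<ge> 1 \<Longrightarrow> n + t * sqrt n \<ge> 0 \<Longrightarrow> n + t * sqrt n \<le> 1 / y * n \<Longrightarrow>
       sqrt n * gpois (a k) (nat \<lfloor>n + t * sqrt n\<rfloor>) n \<le> K k * exp (- c k * t\<^sup>2)"
    by metis
  have csum: "sum c {1..m} > 0" using m Kc(1) by (intro sum_pos) auto
  have "((\<lambda>n. integral\<^sup>L lborel (?s n)) \<longlongrightarrow> integral\<^sup>L lborel ?f) at_top"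
  proof (rule integral_dominated_convergence_at_top[where w = "\<lambda>t. prod K {1..m} * exp (- (sum c {1..m}) * t\<^sup>2)"])
    show "integrable lborel (\<lambda>t. prod K {1..m} * exp (- (sum c {1..m}) * t\<^sup>2))"
      using integral_exp_square(1)[OF csum] by simp
    show "AE t in lborel. ((\<lambda>n. ?s n t) \<longlongrightarrow> ?f t) at_top"
    proof (rule AE_I2)
      show "((\<lambda>n. ?s n t) \<longlongrightarrow> ?f t) at_top" for t
        unfolding h_def by (intro tendsto_mult tendsto_prod gpois_local_limit a indicator_window_tendsto y)
    qed
    show "\<forall>\<^sub>F n in at_top. AE t in lborel. norm (?s n t) \<le> prod K {1..m} * exp (- (sum c {1..m}) * t\<^sup>2)"
      using eventually_ge_at_top[of 1]
    proof eventually_elim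
      case (elim n)
      show ?case
      proof (rule AE_I2)
        fix t
        have K0: "prod K {1..m} \<ge> 0" using Kc(2) by (intro prod_nonneg) auto
        show "norm (?s n t) \<le> prod K {1..m} * exp (- (sum c {1..m}) * t\<^sup>2)"
        proof (cases "n + t * sqrt n \<in> {0..<n / y}")
          case True
          have g0: "0 \<le> sqrt n * gpois (a k) (nat \<lfloor>n + t * sqrt n\<rfloor>) n" if "k \<in> {1..m}" for k
            using gpois_nonneg[OF a[OF that]] elim by simp
          have "(\<Prod>k=1..m. sqrt n * gpois (a k) (nat \<lfloor>n + t * sqrt n\<rfloor>) n) \<le>
              (\<Prod>k=1..m. K k * exp (- c k * t\<^sup>2))"
            using True elim g0 by (intro prod_mono conjI Kc(3)) auto
          also have "\<dots> = prod K {1..m} * exp (- (sum c {1..m}) * t\<^sup>2)"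
            by (simp add: prod.distrib sum_distrib_right sum_negf flip: exp_sum)
          finally have "(\<Prod>k=1..m. sqrt n * gpois (a k) (nat \<lfloor>n + t * sqrt n\<rfloor>) n) \<le>
              prod K {1..m} * exp (- (sum c {1..m}) * t\<^sup>2)" .
          moreover have "(\<Prod>k=1..m. sqrt n * gpois (a k) (nat \<lfloor>n + t * sqrt n\<rfloor>) n) \<ge> 0"
            by (intro prod_nonneg g0)
          ultimately show ?thesis using True by simp
        qed (use K0 in simp)
      qed
    qed
  qed (auto simp: h_def)
  moreover have "integral\<^sup>L lborel ?f = cutoff y / (sqrt (real m) * (2 * pi) powr (real (m - 1) / 2))"
  proof -
    define L where "L = 1 / sqrt (2 * pi) ^ m"
    have m2: "real m / 2 > 0" using m by simp
    have f: "?f t = L * (h t * exp (- (real m / 2) * t\<^sup>2))" for t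
      by (simp add: L_def power_divide flip: exp_of_nat_mult)
    have "(\<integral>t. h t * exp (- (real m / 2) * t\<^sup>2) \<partial>lborel) = cutoff y * sqrt (pi / (real m / 2))"
      using integral_exp_square(2)[OF m2] integral_exp_square_half[OF m2]
      unfolding h_def cutoff_def by (auto simp: not_less)
    then have "integral\<^sup>L lborel ?f = cutoff y * (L * sqrt (2 * pi / real m))"
      unfolding f by (simp add: mult.commute)
    also have "L * sqrt (2 * pi / real m) = 1 / (sqrt (real m) * (2 * pi) powr (real (m - 1) / 2))"
    proof -
      obtain m' where m': "m = Suc m'" using m by (cases m) auto
      have "(2 * pi) powr (real m' / 2) = sqrt (2 * pi) ^ m'"
        by (simp add: powr_half_sqrt[symmetric] powr_powr flip: powr_realpow)
      then show ?thesis unfolding L_def m' by (simp add: real_sqrt_divide)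
    qed
    finally show ?thesis by simp
  qed
  ultimately show ?thesis by simp
qed

text \<open>Of the m factors sqrt n in the product, one is the Jacobian of s = n + t sqrt n; the
  other m - 1 form the power of n on the left.\<close>

lemma sum_gpois_eq_integral:
  assumes "m \<ge> 1" "n > 0"
  shows "n powr (real (m - 1) / 2) * (\<Sum>l<N. \<Prod>k=1..m. gpois (a k) l n) =
         (\<integral>t. indicator {0..<real N} (n + t * sqrt n) *
              (\<Prod>k=1..m. sqrt n * gpois (a k) (nat \<lfloor>n + t * sqrt n\<rfloor>) n) \<partial>lborel)"
proof -
  obtain m' where m': "m = Suc m'" using assms by (cases m) auto
  have p: "n powr (real m' / 2) = sqrt n ^ m'"
    using assms by (simp add: powr_half_sqrt[symmetric] powr_powr flip: powr_realpow)
  have "(\<Sum>l<N. \<Prod>k=1..m. gpois (a k) l n) = sqrt n *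
      (\<integral>t. indicator {0..<real N} (n + sqrt n * t) * (\<Prod>k=1..m. gpois (a k) (nat \<lfloor>n + sqrt n * t\<rfloor>) n) \<partial>lborel)"
    unfolding sum_eq_integral_floor using assms
    by (subst lborel_integral_real_affine[where c = "sqrt n" and t = n]) auto
  then show ?thesis
    unfolding m' by (simp add: p prod.distrib mult_ac del: prod.cl_ivl_Suc flip: integral_mult_right_zero)
qed

section \<open>Exact formulas for the weight and the kernel on the diagonal\<close>

lemma weight_eq_laplace:
  assumes m: "m \<ge> 1" and n: "n > 0" and z: "cmod z = n powr (real m / 2)"
  shows "weight m a z = n powr ((\<Sum>k=1..m. a k) - real (m - 1) / 2) * exp (- (real m * n)) / pi *
     (\<Prod>k=1..m. 1 / Gamma (a k + 1)) *
     (\<integral>v. exp (- (\<Sum>i\<in>{1..<m}. n * gap (v i / sqrt n)) - 1 * (n * gap (- (\<Sum>i\<in>{1..<m}. v i) / sqrt n))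
              + (\<Sum>i\<in>{1..<m}. (a i - a m) * (v i / sqrt n))) \<partial>PiM {1..<m} (\<lambda>_. lborel))"
proof -
  let ?I = "{1..<m}" and ?M = "PiM {1..<m} (\<lambda>_::nat. lborel :: real measure)"
  let ?f = "\<lambda>r. exp (- (\<Sum>k\<in>?I. (r k)\<^sup>2) - (cmod z)\<^sup>2 / (\<Prod>k\<in>?I. (r k)\<^sup>2)) *
            (\<Prod>k\<in>?I. r k powr (2 * (a k - a m) - 1))"
  let ?g = "\<lambda>v. exp (- (\<Sum>i\<in>?I. n * gap (v i / sqrt n)) - 1 * (n * gap (- (\<Sum>i\<in>?I. v i) / sqrt n))
              + (\<Sum>i\<in>?I. (a i - a m) * (v i / sqrt n)))"
  define B where "B = 1 / (2 * sqrt n)"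
  \<comment> \<open>Per coordinate: the power of sqrt n from the integrand, and 1/2 = sqrt n * B
    from the Jacobian. These halves later cancel the 2^(m-1) in \<open>weight\<close>.\<close>
  define P where "P = (\<Prod>i\<in>?I. 1 / 2 * n powr (a i - a m - 1 / 2))"
  define K where "K = P * exp (- (real m * n))"
  have B: "B > 0" "sqrt n * B = 1 / 2" using n by (auto simp: B_def)
  have K: "K \<ge> 0" by (simp add: K_def P_def prod_nonneg)
  have z2: "(cmod z)\<^sup>2 = n ^ m" using n unfolding z
    by (simp add: powr_powr powr_realpow flip: powr_numeral)
  have key: "?f (\<lambda>i\<in>?I. sqrt n * exp (B * v i)) * (\<Prod>i\<in>?I. sqrt n * B * exp (B * v i)) = K * ?g v" for v
  proof -
    define u where "u i = v i / sqrt n" for i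
    have Bu: "B * v i = u i / 2" for i by (simp add: B_def u_def)
    have sq: "(sqrt n * exp (u i / 2))\<^sup>2 = n * exp (u i)" for i
      using n by (simp add: power_mult_distrib flip: exp_double)
    have pr: "(\<Prod>i\<in>?I. n * exp (u i)) = n ^ (m - 1) * exp (sum u ?I)"
      by (simp add: prod.distrib exp_sum)
    have "n ^ m = n * n ^ (m - 1)" using m by (simp flip: power_Suc)
    then have quot: "n ^ m / (\<Prod>i\<in>?I. n * exp (u i)) = n * exp (- sum u ?I)"
      unfolding pr using n by (simp add: exp_minus field_simps)
    have pw: "(sqrt n * exp (u i / 2)) powr (2 * (a i - a m) - 1) * (1 / 2 * exp (u i / 2)) =
        1 / 2 * n powr (a i - a m - 1 / 2) * exp ((a i - a m) * u i)" for i
    proof -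
      have "(sqrt n * exp (u i / 2)) powr (2 * (a i - a m) - 1) =
          n powr (a i - a m - 1 / 2) * exp (u i / 2 * (2 * (a i - a m) - 1))"
        using n by (simp add: powr_mult powr_powr exp_powr_real powr_half_sqrt[symmetric])
          (simp add: field_simps)
      then show ?thesis by (simp add: mult_exp_exp algebra_simps)
    qed
    \<comment> \<open>The deviations u_i and minus their sum add up to zero, so only the m constants
      n survive; they are the source of exp (-m n).\<close>
    have gaps: "(\<Sum>i\<in>?I. n * gap (u i)) + n * gap (- sum u ?I) =
        (\<Sum>i\<in>?I. n * exp (u i)) + n * exp (- sum u ?I) - real m * n"
      using m by (simp add: gap_def sum_subtractf sum.distrib right_diff_distrib sum_distrib_left of_nat_diff)
        (simp add: algebra_simps sum_distrib_left)
    have su: "- (\<Sum>i\<in>?I. v i) / sqrt n = - sum u ?I" by (simp add: u_def sum_divide_distrib)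
    have "?f (\<lambda>i\<in>?I. sqrt n * exp (B * v i)) * (\<Prod>i\<in>?I. sqrt n * B * exp (B * v i)) =
        exp (- (\<Sum>i\<in>?I. n * exp (u i)) - n * exp (- sum u ?I)) *
        (\<Prod>i\<in>?I. (sqrt n * exp (u i / 2)) powr (2 * (a i - a m) - 1) * (1 / 2 * exp (u i / 2)))"
    proof -
      have "?f (\<lambda>i\<in>?I. sqrt n * exp (B * v i)) = exp (- (\<Sum>i\<in>?I. n * exp (u i)) - n * exp (- sum u ?I)) *
          (\<Prod>i\<in>?I. (sqrt n * exp (u i / 2)) powr (2 * (a i - a m) - 1))"
        unfolding Bu z2 quot[symmetric] by (simp add: sq)
      then show ?thesis unfolding Bu B(2) by (simp only: prod.distrib mult.assoc)
    qed
    also have "\<dots> = P * (exp (- (\<Sum>i\<in>?I. n * exp (u i)) - n * exp (- sum u ?I)) *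
        exp (\<Sum>i\<in>?I. (a i - a m) * u i))"
      unfolding pw P_def exp_sum[OF finite_atLeastLessThan] by (simp only: prod.distrib mult_ac)
    also have "\<dots> = K * exp (- (\<Sum>i\<in>?I. n * gap (u i)) - 1 * (n * gap (- sum u ?I)) + (\<Sum>i\<in>?I. (a i - a m) * u i))"
      unfolding K_def mult.assoc mult_exp_exp using gaps by (simp add: algebra_simps)
    finally show ?thesis unfolding su u_def .
  qed
  \<comment> \<open>For a nonnegative measurable integrand the two sides agree even if the integral
    diverges, as both are then 0.\<close>
  have "set_lebesgue_integral ?M (PiE ?I (\<lambda>_. {0<..})) ?f =
      enn2real (\<integral>\<^sup>+r. ennreal (indicator (PiE ?I (\<lambda>_. {0<..})) r *\<^sub>R ?f r) \<partial>?M)"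
    unfolding set_lebesgue_integral_def
  proof (rule integral_eq_nn_integral)
    show "AE r in ?M. 0 \<le> indicator (PiE ?I (\<lambda>_. {0<..})) r *\<^sub>R ?f r"
      by (intro AE_I2 scaleR_nonneg_nonneg mult_nonneg_nonneg prod_nonneg) auto
  qed (auto intro!: borel_measurable_scaleR borel_measurable_indicator sets_PiM_I_finite)
  also have "(\<integral>\<^sup>+r. ennreal (indicator (PiE ?I (\<lambda>_. {0<..})) r *\<^sub>R ?f r) \<partial>?M) =
      (\<integral>\<^sup>+r. ennreal (?f r) * (\<Prod>i\<in>?I. indicator {0<..} (r i)) \<partial>?M)"
  proof (rule nn_integral_cong)
    fix r assume "r \<in> space ?M"
    then have ext: "r \<in> extensional ?I" by (auto simp: space_PiM PiE_def)
    show "ennreal (indicator (PiE ?I (\<lambda>_. {0<..})) r *\<^sub>R ?f r) =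
        ennreal (?f r) * (\<Prod>i\<in>?I. indicator {0<..} (r i))"
    proof (cases "\<forall>i\<in>?I. r i > 0")
      case True
      then show ?thesis using ext by (simp add: PiE_def indicator_def)
    next
      case False
      then have "r \<notin> PiE ?I (\<lambda>_. {0<..})" by auto
      moreover have "(\<Prod>i\<in>?I. indicator {0<..} (r i) :: ennreal) = 0"
        using False by (intro prod_zero) (auto simp: indicator_def Bex_def)
      ultimately show ?thesis by simp
    qed
  qed
  also have "\<dots> = (\<integral>\<^sup>+v. ennreal (?f (\<lambda>i\<in>?I. sqrt n * exp (B * v i))) *
      (\<Prod>i\<in>?I. ennreal (sqrt n * B * exp (B * v i))) \<partial>?M)"
    by (rule nn_integral_PiM_exp_substitution) (use n B in auto)
  also have "\<dots> = (\<integral>\<^sup>+v. ennreal (K * ?g v) \<partial>?M)"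
  proof (rule nn_integral_cong)
    fix v
    have pe: "(\<Prod>i\<in>?I. ennreal (sqrt n * B * exp (B * v i))) = ennreal (\<Prod>i\<in>?I. sqrt n * B * exp (B * v i))"
      using n B by (intro prod_ennreal) auto
    show "ennreal (?f (\<lambda>i\<in>?I. sqrt n * exp (B * v i))) *
        (\<Prod>i\<in>?I. ennreal (sqrt n * B * exp (B * v i))) = ennreal (K * ?g v)"
      unfolding key[symmetric] pe
      by (rule ennreal_mult''[symmetric]) (use n B in \<open>auto intro!: prod_nonneg\<close>)
  qed
  also have "enn2real \<dots> = (\<integral>v. K * ?g v \<partial>?M)"
    by (rule integral_eq_nn_integral[symmetric]) (use K in auto)
  also have "\<dots> = K * (\<integral>v. ?g v \<partial>?M)" by simp
  finally have int: "set_lebesgue_integral ?M (PiE ?I (\<lambda>_. {0<..})) ?f = K * (\<integral>v. ?g v \<partial>?M)" .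
  have P: "P = 1 / 2 ^ (m - 1) * n powr (\<Sum>i\<in>?I. a i - a m - 1 / 2)"
    using n unfolding P_def prod.distrib by (simp add: powr_sum power_divide)
  have "{1..m} = insert m ?I" using m by auto
  then have "sum a {1..m} = a m + sum a ?I" by simp
  \<comment> \<open>The factor |z|^(2 a_m) equals n^(m a_m); it offsets the m - 1 subtracted copies
    of a_m and leaves the one missing from the sum over \<open>?I\<close>.\<close>
  then have "real m * a m + (\<Sum>i\<in>?I. a i - a m - 1 / 2) = sum a {1..m} - real (m - 1) / 2"
    using m by (simp add: sum_subtractf of_nat_diff algebra_simps)
  then have pow: "cmod z powr (2 * a m) * n powr (\<Sum>i\<in>?I. a i - a m - 1 / 2) =
      n powr (sum a {1..m} - real (m - 1) / 2)"
    unfolding z powr_powr by (simp flip: powr_add)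
  show ?thesis
    unfolding weight_def int K_def P pow[symmetric] by simp
qed

text \<open>On the diagonal the root of the squared weight is the weight itself and z times its
  conjugate is n^m. The factor n^(sum of a_k) exp (-m n) of the weight then supplies what each
  coefficient lacks to be a product of m values of \<open>gpois\<close>.\<close>

lemma one_point_corr_eq:
  assumes m: "m \<ge> 1" and a: "\<And>k. k \<in> {1..m} \<Longrightarrow> a k > -1" and n: "n > 0"
    and z: "cmod z = n powr (real m / 2)"
  shows "one_point_corr m a N z = of_real (n powr (- (real (m - 1) / 2)) / pi *
     (\<integral>v. exp (- (\<Sum>i\<in>{1..<m}. n * gap (v i / sqrt n)) - 1 * (n * gap (- (\<Sum>i\<in>{1..<m}. v i) / sqrt n))
              + (\<Sum>i\<in>{1..<m}. (a i - a m) * (v i / sqrt n))) \<partial>PiM {1..<m} (\<lambda>_. lborel)) *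
     (\<Sum>l<N. \<Prod>k=1..m. gpois (a k) l n))"
    (is "_ = of_real (_ / pi * ?J * ?S)")
proof -
  let ?W = "n powr (- (real (m - 1) / 2)) / pi * ?J"
  have J: "?J \<ge> 0" by simp
  have G0: "Gamma (a k + 1) > 0" if "k \<in> {1..m}" for k
    using a[OF that] by (intro Gamma_real_pos) auto
  have w: "weight m a z = ?W * (n powr (\<Sum>k=1..m. a k) * exp (- (real m * n))) * (\<Prod>k=1..m. 1 / Gamma (a k + 1))"
  proof -
    have p: "n powr (s - d) = n powr (- d) * n powr s" for s d by (simp flip: powr_add)
    show ?thesis unfolding weight_eq_laplace[OF m n z] p divide_inverse by (simp only: mult_ac)
  qed
  have w0: "weight m a z \<ge> 0"
    unfolding w using J G0 by (intro mult_nonneg_nonneg prod_nonneg divide_nonneg_nonneg) (auto simp: less_imp_le)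
  have wc: "weight m a (cnj z) = weight m a z" unfolding weight_def by simp
  have z2: "z * cnj z = of_real (n ^ m)"
    using n unfolding complex_norm_square[symmetric] z
    by (simp add: powr_powr powr_realpow flip: powr_numeral of_real_power)
  have summand: "weight m a z * ((\<Prod>k=1..m. Gamma (a k + 1) / Gamma (a k + real l + 1)) * (n ^ m) ^ l) =
      ?W * (\<Prod>k=1..m. gpois (a k) l n)" for l
  proof -
    have "(\<Prod>k=1..m. gpois (a k) l n) =
        (\<Prod>k=1..m. n powr (a k) * n ^ l * exp (- n) * (1 / Gamma (a k + real l + 1)))"
      using n by (intro prod.cong) (auto simp: gpois_def powr_add powr_realpow)
    also have "\<dots> = n powr (\<Sum>k=1..m. a k) * (n ^ m) ^ l * exp (- (real m * n)) *
        (\<Prod>k=1..m. 1 / Gamma (a k + real l + 1))"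
      unfolding prod.distrib using n
      by (simp add: powr_sum exp_of_nat_mult[symmetric] mult.commute flip: power_mult)
    finally have g: "(\<Prod>k=1..m. gpois (a k) l n) = \<dots>" .
    have GG: "(\<Prod>k=1..m. 1 / Gamma (a k + 1)) * (\<Prod>k=1..m. Gamma (a k + 1) / Gamma (a k + real l + 1)) =
        (\<Prod>k=1..m. 1 / Gamma (a k + real l + 1))"
      unfolding prod.distrib[symmetric] using G0 by (intro prod.cong) (auto simp: less_imp_neq[symmetric])
    show ?thesis unfolding g w GG[symmetric] by (simp only: mult_ac)
  qed
  have "one_point_corr m a N z = of_real (weight m a z * (\<Sum>l<N.
      (\<Prod>k=1..m. Gamma (a k + 1) / Gamma (a k + real l + 1)) * (n ^ m) ^ l))"
    unfolding one_point_corr_def kernel_def wc z2 using w0 by simp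
  also have "\<dots> = of_real (?W * ?S)"
    unfolding sum_distrib_left summand ..
  finally show ?thesis .
qed

section \<open>The limiting density\<close>

theorem theorem3p6:
  fixes m :: nat and a :: "nat \<Rightarrow> real" and z :: complex
  assumes "m \<ge> 1"
    and "\<And>k. k \<in> {1..m} \<Longrightarrow> a k > -1"
    and "z \<noteq> 0"
  shows "(\<lambda>N::nat. of_nat N ^ (m - 1) *
            one_point_corr m a N (of_real (real N powr (real m / 2)) * z))
         \<longlonglongrightarrow> of_real (1 / (real m * pi) * cmod z powr (2 / real m - 2) * chi_disc z)"
proof -
  let ?J = "\<lambda>n. \<integral>v. exp (- (\<Sum>i\<in>{1..<m}. n * gap (v i / sqrt n)) - 1 * (n * gap (- (\<Sum>i\<in>{1..<m}. v i) / sqrt n))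
              + (\<Sum>i\<in>{1..<m}. (a i - a m) * (v i / sqrt n))) \<partial>PiM {1..<m} (\<lambda>_. lborel)"
  \<comment> \<open>Chosen so that the rescaled point has modulus n^(m/2) with n = N y.\<close>
  define y where "y = cmod z powr (2 / real m)"
  let ?Q = "\<lambda>n. \<integral>t. indicator {0..<n / y} (n + t * sqrt n) *
              (\<Prod>k=1..m. sqrt n * gpois (a k) (nat \<lfloor>n + t * sqrt n\<rfloor>) n) \<partial>lborel"
  have m: "real m > 0" using assms(1) by simp
  have y: "y > 0" using assms(3) by (simp add: y_def)
  have ym: "y powr (real m / 2) = cmod z" using m assms(3) by (simp add: y_def powr_powr)
  have y1: "y powr (1 - real m) = cmod z powr (2 / real m - 2)"
    using m by (simp add: y_def powr_powr field_simps)
  have chi: "cutoff y = chi_disc z"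
  proof -
    have p: "2 / real m > 0" using m by simp
    have z: "0 \<le> cmod z" "cmod z \<noteq> 0" using assms(3) by auto
    consider "cmod z < 1" | "cmod z = 1" | "cmod z > 1" by linarith
    then show ?thesis
    proof cases
      case 1
      then have "y < 1" using powr_less_mono2[OF p z(1) 1] by (simp add: y_def)
      with 1 show ?thesis by (simp add: cutoff_def chi_disc_def)
    next
      case 2
      then show ?thesis by (simp add: cutoff_def chi_disc_def y_def)
    next
      case 3
      then have "y > 1" using powr_less_mono2[OF p _ 3] by (simp add: y_def)
      with 3 show ?thesis by (simp add: cutoff_def chi_disc_def)
    qed
  qed
  have "filterlim (\<lambda>N. y * real N) at_top sequentially"
    by (rule filterlim_tendsto_pos_mult_at_top[OF tendsto_const y filterlim_real_sequentially])
  then have lim: "filterlim (\<lambda>N. real N * y) at_top sequentially" by (simp add: mult.commute)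
  let ?p = "(2 * pi) powr (real (m - 1) / 2)"
  have J: "(\<lambda>N. ?J (real N * y)) \<longlonglongrightarrow> ?p / sqrt (real m)"
    using filterlim_compose[OF laplace_PiM[of "{1..<m}" 1 "\<lambda>i. a i - a m"] lim] assms(1)
    by (simp add: of_nat_diff)
  have Q: "(\<lambda>N. ?Q (real N * y)) \<longlonglongrightarrow> cutoff y / (sqrt (real m) * ?p)"
    by (rule filterlim_compose[OF gpois_prod_integral_tendsto lim]) (use assms y in auto)
  have "(\<lambda>N. complex_of_real (y powr (1 - real m) / pi * ?J (real N * y) * ?Q (real N * y)))
      \<longlonglongrightarrow> of_real (y powr (1 - real m) / pi * (?p / sqrt (real m)) * (cutoff y / (sqrt (real m) * ?p)))"
    by (intro tendsto_intros J Q)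
  also have "y powr (1 - real m) / pi * (?p / sqrt (real m)) * (cutoff y / (sqrt (real m) * ?p)) =
      1 / (real m * pi) * cmod z powr (2 / real m - 2) * chi_disc z"
    unfolding y1 chi using m by simp
  finally show ?thesis
  proof (rule Lim_transform_eventually)
    show "\<forall>\<^sub>F N in sequentially.
        complex_of_real (y powr (1 - real m) / pi * ?J (real N * y) * ?Q (real N * y)) =
        of_nat N ^ (m - 1) * one_point_corr m a N (of_real (real N powr (real m / 2)) * z)"
      using eventually_gt_at_top[of 0]
    proof eventually_elim
      case (elim N)
      define n where "n = real N * y"
      have n: "n > 0" using elim y by (simp add: n_def)
      have nz: "cmod (of_real (real N powr (real m / 2)) * z) = n powr (real m / 2)"
        using elim y ym by (simp add: n_def norm_mult powr_mult)
      have Q: "?Q n = n powr (real (m - 1) / 2) * (\<Sum>l<N. \<Prod>k=1..m. gpois (a k) l n)"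
        using y unfolding sum_gpois_eq_integral[OF assms(1) n] by (simp add: n_def)
      \<comment> \<open>N^(m-1) = (n / y)^(m-1): half of the power of n cancels the one in the
        weight, the other half normalises the sum, and y^(1-m) = |z|^(2/m - 2) remains.\<close>
      have pow: "y powr (1 - real m) * n powr (real (m - 1) / 2) = real N ^ (m - 1) * n powr (- (real (m - 1) / 2))"
      proof -
        have "real N ^ (m - 1) = (n / y) powr real (m - 1)"
          using elim y by (simp add: n_def powr_realpow)
        also have "\<dots> = n powr (real (m - 1) / 2) * n powr (real (m - 1) / 2) * y powr (1 - real m)"
          using n y assms(1) by (simp add: powr_divide of_nat_diff powr_minus_divide[symmetric] flip: powr_add)
            (simp add: powr_minus_divide[symmetric] divide_powr_uminus)
        finally show ?thesis using n by (simp add: powr_minus)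
      qed
      have "of_nat N ^ (m - 1) * one_point_corr m a N (of_real (real N powr (real m / 2)) * z) =
          of_real (real N ^ (m - 1) * n powr (- (real (m - 1) / 2)) / pi * ?J n *
            (\<Sum>l<N. \<Prod>k=1..m. gpois (a k) l n))"
        by (subst one_point_corr_eq[OF assms(1,2) n nz]) simp_all
      also have "\<dots> = of_real (y powr (1 - real m) / pi * ?J n * ?Q n)"
        unfolding Q pow[symmetric] by (simp add: mult_ac)
      finally show ?case by (simp add: n_def)
    qed
  qed
qed

end
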